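(* Let $M \ge 2$, $N\ge1$ be integers with $\operatorname{rad}(M) \nmid \operatorname{rad}(N)$, let $\xi$ be a primitive $M$-th root of unity, let $r\ge1$, let $p_1,\dots,p_r$ be non-negative integers, and let $x, y_1,\dots,y_r\in\mathbb{C}$. For each $q\ge0$ let $(\beta_k^{(q)})_{k\ge0}$ be defined by $\sum_{k\ge 0}\beta_k^{(q)} z^k = G_q(z)/(1-z)^{q+1}$ with $G_q(z)=\sum_{m=0}^{M^{q+1}-1}\xi^{\mathcal{B}_{M,N}(m)}z^m$. Then for every function $f:\mathbb{C}\to\mathbb{C}$, $$\sum_{n_1=0}^{M^{p_1+1}-1} \cdots \sum_{n_r=0}^{M^{p_r+1}-1} \xi^{\sum_{j=1}^r \mathcal{B}_{M,N}(n_j)} f\Big(x + \sum_{j=1}^r n_j y_j\Big) = (-1)^{\sum_{j=1}^r (p_j+1)} \sum_{k_1=0}^{M^{p_1+1}-p_1-2}\cdots\sum_{k_r=0}^{M^{p_r+1}-p_r-2} \Big(\prod_{j=1}^r \beta_{k_j}^{(p_j)}\Big) \Big(\Big(\prod_{j=1}^r \Delta_{y_j}^{p_j+1}\Big) f\Big)\Big(x + \sum_{j=1}^r k_j y_j\Big),$$ where for $g:\mathbb{C}\to\mathbb{C}$, $\Delta_y^{q} g(u) := \sum_{i=0}^{q} (-1)^{q-i}\binom{q}{i} g(u+iy)$, and $\prod_{j=1}^r \Delta_{y_j}^{p_j+1}$ denotes the composition of these (commuting) operators.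
   Context: For integers $M\ge 2$, $N \ge 1$ and $n\ge 0$ with base-$M$ expansion $n=\sum_{i\ge 0} d_i(n) M^i$, $d_i(n)\in\{0,\dots,M-1\}$, the base-shifting map is $\mathcal{B}_{M,N}(n) := \sum_{i\ge 0} d_i(n) N^i$. $\operatorname{rad}(k)$ is the product of the distinct prime factors of $k$. Under the hypothesis, $G_q(z)$ is divisible by $(1-z)^{q+1}$, so $\beta_k^{(q)}=0$ for $k > M^{q+1}-q-2$. *)

theory Defs
  imports
    Complex_Main
    "HOL-Library.FuncSet"
    "HOL-Computational_Algebra.Computational_Algebra"
begin

definition digit :: "nat \<Rightarrow> nat \<Rightarrow> nat \<Rightarrow> nat" where
  "digit M n i = n div M ^ i mod M"

text \<open>The sum over all \<open>i \<ge> 0\<close> is taken over the indices of nonzero digits; by \<open>finite_digits\<close>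
  this is a finite set for \<open>M \<ge> 2\<close>, so the sum does not degenerate.\<close>
definition base_shift :: "nat \<Rightarrow> nat \<Rightarrow> nat \<Rightarrow> nat" where
  "base_shift M N n = (\<Sum>i | digit M n i \<noteq> 0. digit M n i * N ^ i)"

lemma finite_digits:
  assumes "M \<ge> 2"
  shows "finite {i. digit M n i \<noteq> 0}"
proof (rule finite_subset)
  have "n < M ^ i" if "n \<le> i" for i
  proof -
    have "i < 2 ^ i" by (rule less_exp)
    also have "(2::nat) ^ i \<le> M ^ i" using assms by (rule power_mono) simp
    finally show ?thesis using that by simp
  qed
  then show "{i. digit M n i \<noteq> 0} \<subseteq> {..<n}"
    unfolding digit_def by (force simp: not_less[symmetric])
qed simp

definition rad :: "nat \<Rightarrow> nat" where
  "rad k = \<Prod>(prime_factors k)"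

definition primitive_root_of_unity :: "nat \<Rightarrow> complex \<Rightarrow> bool" where
  "primitive_root_of_unity M \<xi> \<longleftrightarrow> \<xi> ^ M = 1 \<and> (\<forall>k. 0 < k \<and> k < M \<longrightarrow> \<xi> ^ k \<noteq> 1)"

definition G :: "nat \<Rightarrow> nat \<Rightarrow> complex \<Rightarrow> nat \<Rightarrow> complex poly" where
  "G M N \<xi> q = (\<Sum>m<M ^ (q + 1). monom (\<xi> ^ base_shift M N m) m)"

text \<open>The generating function is read as a formal power series; the divisor has constant
  coefficient 1, hence is a unit.\<close>
definition beta :: "nat \<Rightarrow> nat \<Rightarrow> complex \<Rightarrow> nat \<Rightarrow> nat \<Rightarrow> complex" where
  "beta M N \<xi> q k = fps_nth (fps_of_poly (G M N \<xi> q) / (1 - fps_X) ^ (q + 1)) k"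

definition Delta :: "complex \<Rightarrow> nat \<Rightarrow> (complex \<Rightarrow> complex) \<Rightarrow> complex \<Rightarrow> complex" where
  "Delta y q g u = (\<Sum>i\<le>q. (-1) ^ (q - i) * of_nat (q choose i) * g (u + of_nat i * y))"

text \<open>The composition of the operators for \<open>j = 1, \<dots>, r\<close>, the one with \<open>j = r\<close> acting first
  (the operators commute).\<close>
definition Delta_prod ::
  "nat \<Rightarrow> (nat \<Rightarrow> complex) \<Rightarrow> (nat \<Rightarrow> nat) \<Rightarrow> (complex \<Rightarrow> complex) \<Rightarrow> complex \<Rightarrow> complex" where
  "Delta_prod r y q = foldr (\<circ>) (map (\<lambda>j. Delta (y j) (q j)) [1..<Suc r]) id"

end

theory Submission
  imports Defs
begin

text \<open>By uniqueness of digits, \<open>G\<^sub>q\<close> factors as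
  \<open>\<Prod>i\<le>q. \<Sum>d<M. \<xi>^(d N^i) z^(d M^i)\<close>. At \<open>z = 1\<close> each factor is a geometric sum in the
  \<open>M\<close>-th root of unity \<open>\<xi>^(N^i)\<close>, which differs from 1 because \<open>rad M\<close> does not divide \<open>rad N\<close>; so
  \<open>(1 - z)^(q+1)\<close> divides \<open>G\<^sub>q\<close>, and the \<open>\<beta>\<^sub>k\<close> are the coefficients of the quotient. Replacing \<open>z^n\<close>
  by \<open>f (x + n y)\<close> turns multiplication by \<open>1 - z\<close> into \<open>-\<Delta>\<^sub>y\<close>, which is the case \<open>r = 1\<close>. The
  general case follows by induction on \<open>r\<close>, applying the case of one variable to the last
  coordinate.\<close>

text \<open>A prime dividing \<open>M\<close> divides \<open>N ^ i\<close>, hence \<open>N\<close>.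
  Used contrapositively: under the hypothesis on radicals \<open>M\<close> divides no power of
  \<open>N\<close>, so no \<open>\<xi> ^ (N ^ i)\<close> equals 1.\<close>

lemma rad_dvd_rad:
  assumes "M dvd N ^ i" and "N \<ge> 1"
  shows "rad M dvd rad N"
proof -
  have "prime_factors M \<subseteq> prime_factors N"
    using assms by (auto simp: in_prime_factors_iff) (metis dvd_trans prime_dvd_power)
  then show ?thesis
    unfolding rad_def by (intro prod_dvd_prod_subset) auto
qed

lemma primitive_root_power_eq_1_imp_dvd:
  assumes "primitive_root_of_unity M \<xi>" and "M > 0" and "\<xi> ^ k = 1"
  shows "M dvd k"
proof -
  have "\<xi> ^ k = (\<xi> ^ M) ^ (k div M) * \<xi> ^ (k mod M)"
    by (simp flip: power_mult power_add)
  then have "\<xi> ^ (k mod M) = 1"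
    using assms by (simp add: primitive_root_of_unity_def)
  then have "k mod M = 0"
    using assms by (auto simp: primitive_root_of_unity_def)
  then show ?thesis by auto
qed

lemma base_shift_eq_sum:
  assumes "n < M ^ K"
  shows "base_shift M N n = (\<Sum>i<K. digit M n i * N ^ i)"
  unfolding base_shift_def
proof (rule sum.mono_neutral_left)
  show "{i. digit M n i \<noteq> 0} \<subseteq> {..<K}"
  proof
    fix i assume "i \<in> {i. digit M n i \<noteq> 0}"
    then have nz: "digit M n i \<noteq> 0" by simp
    have "i < K"
    proof (rule ccontr)
      assume "\<not> i < K"
      then have "M ^ K \<le> M ^ i" if "M > 0"
        using that by (intro power_increasing) auto
      then show False
        \<comment> \<open>For \<open>M = 0\<close> the bound \<open>n < M ^ K\<close> forces
          \<open>K = 0\<close> and \<open>n = 0\<close>, whose digits all vanish.\<close>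
        using assms nz by (cases "M = 0"; cases K) (auto simp: digit_def)
    qed
    then show "i \<in> {..<K}" by simp
  qed
qed auto

text \<open>For \<open>i < K\<close> the number \<open>d * M ^ K\<close> is a multiple of
  \<open>M ^ (i + 1)\<close>, so adding it leaves digit \<open>i\<close> unchanged; digit
  \<open>K\<close> becomes \<open>d\<close> because \<open>m < M ^ K\<close>.\<close>

lemma base_shift_add_top_digit:
  assumes "m < M ^ K" and "d < M"
  shows "base_shift M N (d * M ^ K + m) = base_shift M N m + d * N ^ K"
proof -
  have "M > 0" using assms by simp
  have "(d + 1) * M ^ K \<le> M * M ^ K"
    using assms by (intro mult_right_mono) auto
  then have less: "d * M ^ K + m < M ^ Suc K"
    using assms by simp
  have "digit M (d * M ^ K + m) i = digit M m i" if "i < K" for i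
  proof -
    have "M ^ K = M * M ^ (K - i - 1) * M ^ i"
      using that by (simp flip: power_Suc power_add)
    then have "d * M ^ K + m = m + (M * (d * M ^ (K - i - 1))) * M ^ i"
      by (simp only: ac_simps)
    also have "\<dots> div M ^ i = M * (d * M ^ (K - i - 1)) + m div M ^ i"
      using \<open>M > 0\<close> by (intro div_mult_self1) simp
    finally have "(d * M ^ K + m) div M ^ i = M * (d * M ^ (K - i - 1)) + m div M ^ i" .
    then show ?thesis
      by (simp add: digit_def)
  qed
  moreover have "digit M (d * M ^ K + m) K = d"
    using assms by (simp add: digit_def)
  ultimately show ?thesis
    using base_shift_eq_sum[OF less] base_shift_eq_sum[OF assms(1)] by simp
qed

text \<open>Cut the range below \<open>M ^ Suc K\<close> into \<open>M\<close> blocks of length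
  \<open>M ^ K\<close>, one for each value \<open>d\<close> of the top digit. Within a block the
  summand splits into a factor depending on \<open>d\<close> and one depending on
  \<open>m\<close>.\<close>

lemma shift_poly_factor:
  fixes \<xi> :: complex
  shows "(\<Sum>m<M ^ Suc K. monom (\<xi> ^ base_shift M N m) m) =
    (\<Sum>d<M. monom (\<xi> ^ (d * N ^ K)) (d * M ^ K)) * (\<Sum>m<M ^ K. monom (\<xi> ^ base_shift M N m) m)"
proof -
  have "(\<Sum>m<M ^ Suc K. monom (\<xi> ^ base_shift M N m) m) =
      (\<Sum>d<M. \<Sum>m=d * M ^ K..<d * M ^ K + M ^ K. monom (\<xi> ^ base_shift M N m) m)"
    by (simp add: sum.nat_group)
  also have "\<dots> = (\<Sum>d<M. \<Sum>m<M ^ K. monom (\<xi> ^ base_shift M N (d * M ^ K + m)) (d * M ^ K + m))"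
    by (rule sum.cong[OF refl])
      (simp add: sum.atLeastLessThan_shift_0[of _ "_ * _"] lessThan_atLeast0 comp_def)
  also have "\<dots> = (\<Sum>d<M. \<Sum>m<M ^ K. monom (\<xi> ^ (d * N ^ K)) (d * M ^ K) *
      monom (\<xi> ^ base_shift M N m) m)"
    by (intro sum.cong refl)
      (simp add: base_shift_add_top_digit mult_monom flip: power_add, simp add: add.commute)
  finally show ?thesis
    by (simp add: sum_product)
qed

lemma one_minus_X_power_dvd_shift_poly:
  fixes \<xi> :: complex
  assumes "M \<ge> 2" and "N \<ge> 1" and "\<not> rad M dvd rad N" and prim: "primitive_root_of_unity M \<xi>"
  shows "[:1, -1:] ^ K dvd (\<Sum>m<M ^ K. monom (\<xi> ^ base_shift M N m) m)"
proof (induction K)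
  case (Suc K)
  have ne: "\<xi> ^ N ^ K \<noteq> 1"
    using primitive_root_power_eq_1_imp_dvd[OF prim] rad_dvd_rad assms by force
  have "(\<xi> ^ N ^ K) ^ M = (\<xi> ^ M) ^ N ^ K"
    by (simp add: mult.commute flip: power_mult)
  then have "(\<Sum>d<M. (\<xi> ^ N ^ K) ^ d) = 0"
    using ne prim by (simp add: sum_gp_strict primitive_root_of_unity_def)
  then have "poly (\<Sum>d<M. monom (\<xi> ^ (d * N ^ K)) (d * M ^ K)) 1 = 0"
    by (simp add: poly_sum poly_monom mult.commute[of _ "N ^ K"] power_mult)
  \<comment> \<open>The root criterion provides the divisor z - 1, which is
    \<open>- [:1, -1:]\<close>; the sign is dropped next.\<close>
  then have "- [:1, -1:] dvd (\<Sum>d<M. monom (\<xi> ^ (d * N ^ K)) (d * M ^ K))"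
    by (simp add: poly_eq_0_iff_dvd)
  then have "[:1, -1:] dvd (\<Sum>d<M. monom (\<xi> ^ (d * N ^ K)) (d * M ^ K))"
    by (simp only: minus_dvd_iff)
  from mult_dvd_mono[OF this Suc.IH] show ?case
    unfolding shift_poly_factor by simp
qed simp

lemma sum_coeff_mult:
  fixes P R :: "'a :: comm_semiring_1 poly"
  assumes "degree P \<le> a" and "degree R \<le> b"
  shows "(\<Sum>n\<le>a + b. coeff (P * R) n * g n) =
    (\<Sum>k\<le>b. \<Sum>i\<le>a. coeff P i * coeff R k * g (i + k))"
proof -
  define h where "h i k = coeff P i * coeff R k * g (i + k)" for i k
  have fin: "finite {(i, k). i + k \<le> a + b}"
    by (rule finite_subset[of _ "{..a + b} \<times> {..a + b}"]) auto
  have "(\<Sum>n\<le>a + b. coeff (P * R) n * g n) = (\<Sum>n\<le>a + b. \<Sum>i\<le>n. h i (n - i))"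
    by (simp add: coeff_mult sum_distrib_right h_def)
  also have "\<dots> = (\<Sum>(i, k)\<in>{(i, k). i + k \<le> a + b}. h i k)"
    by (rule sum.triangle_reindex_eq[symmetric])
  \<comment> \<open>The box lies inside the triangle, and outside the box one of the two
    coefficients is zero by the degree bounds.\<close>
  also have "\<dots> = (\<Sum>(i, k)\<in>{..a} \<times> {..b}. h i k)"
    using assms fin
    by (intro sum.mono_neutral_right)
      (auto simp: h_def, (metis le_degree mult_zero_left mult_zero_right order_trans)+)
  also have "\<dots> = (\<Sum>k\<le>b. \<Sum>i\<le>a. h i k)"
    by (subst sum.swap) (simp add: sum.cartesian_product)
  finally show ?thesis
    by (simp add: h_def)
qed

lemma sum_coeff_one_minus_X_power_mult:
  fixes R :: "complex poly"
  assumes "degree R \<le> b"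
  shows "(\<Sum>n\<le>q + b. coeff ([:1, -1:] ^ q * R) n * f (x + of_nat n * y)) =
    (-1) ^ q * (\<Sum>k\<le>b. coeff R k * Delta y q f (x + of_nat k * y))"
proof -
  have "degree ([:1, -1:] ^ q :: complex poly) \<le> q"
    by (simp add: degree_linear_power)
  \<comment> \<open>The coefficient carries the sign \<open>(-1) ^ i\<close>, whereas
    \<open>Delta\<close> uses \<open>(-1) ^ (q - i)\<close>. The discrepancy \<open>(-1) ^ q\<close>
    does not depend on \<open>i\<close> and becomes the global sign.\<close>
  moreover have "coeff ([:1, -1:] ^ q) i = (-1) ^ q * ((-1) ^ (q - i) * (of_nat (q choose i) :: complex))"
    if "i \<le> q" for i
  proof -
    have "(-1) ^ i = (-1) ^ q * ((-1) ^ (q - i) :: complex)"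
      using that by (auto simp: minus_one_power_iff)
    then show ?thesis
      using that by (simp add: coeff_linear_poly_power)
  qed
  then have "(\<Sum>i\<le>q. coeff ([:1, -1:] ^ q) i * c * f (x + of_nat (i + k) * y)) =
      (-1) ^ q * (c * Delta y q f (x + of_nat k * y))" for c k
    unfolding Delta_def sum_distrib_left by (intro sum.cong refl) (simp add: algebra_simps)
  ultimately show ?thesis
    using assms by (simp add: sum_coeff_mult sum_distrib_left)
qed

lemma sum_shift_eq_sum_Delta:
  assumes "M \<ge> 2" and "N \<ge> 1" and "\<not> rad M dvd rad N" and "primitive_root_of_unity M \<xi>"
  shows "(\<Sum>n=0..M ^ (q + 1) - 1. \<xi> ^ base_shift M N n * f (x + of_nat n * y)) =
    (-1) ^ (q + 1) *
      (\<Sum>k=0..M ^ (q + 1) - q - 2. beta M N \<xi> q k * Delta y (q + 1) f (x + of_nat k * y))"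
proof -
  obtain R where R: "G M N \<xi> q = [:1, -1:] ^ (q + 1) * R"
    using one_minus_X_power_dvd_shift_poly[OF assms] unfolding G_def dvd_def by blast
  \<comment> \<open>This keeps the natural subtraction in \<open>M ^ (q + 1) - q - 2\<close> from
    truncating.\<close>
  have "q + 1 < 2 ^ (q + 1)"
    by (rule less_exp)
  also have "(2::nat) ^ (q + 1) \<le> M ^ (q + 1)"
    using assms by (intro power_mono) auto
  finally have less: "q + 1 < M ^ (q + 1)" .
  have coeff_G: "coeff (G M N \<xi> q) n = (if n < M ^ (q + 1) then \<xi> ^ base_shift M N n else 0)" for n
    by (auto simp: G_def coeff_sum)
  have deg: "degree R \<le> M ^ (q + 1) - q - 2"
  proof (cases "R = 0")
    case False
    have "degree (G M N \<xi> q) = q + 1 + degree R"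
      unfolding R using False
      by (subst degree_mult_eq) (auto simp: degree_linear_power simp del: power_Suc)
    moreover have "degree (G M N \<xi> q) \<le> M ^ (q + 1) - 1"
      by (rule degree_le) (auto simp: coeff_G)
    ultimately show ?thesis by simp
  qed simp
  have "fps_of_poly (G M N \<xi> q) = (1 - fps_X) ^ (q + 1) * fps_of_poly R"
    by (simp add: R fps_of_poly_mult fps_of_poly_power fps_of_poly_pCons del: power_Suc)
  moreover have "fps_nth (1 - fps_X :: complex fps) 0 \<noteq> 0"
    by simp
  then have "(1 - fps_X :: complex fps) \<noteq> 0"
    by (metis fps_zero_nth)
  ultimately have "fps_of_poly (G M N \<xi> q) / (1 - fps_X) ^ (q + 1) = fps_of_poly R"
    by (simp only: nonzero_mult_div_cancel_left power_not_zero not_False_eq_True)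
  then have beta: "beta M N \<xi> q k = coeff R k" for k
    by (simp add: beta_def)
  \<comment> \<open>The two upper limits agree: \<open>q + 1\<close> plus the degree bound for
    \<open>R\<close> is \<open>M ^ (q + 1) - 1\<close>.\<close>
  have "(\<Sum>n=0..M ^ (q + 1) - 1. \<xi> ^ base_shift M N n * f (x + of_nat n * y)) =
      (\<Sum>n\<le>(q + 1) + (M ^ (q + 1) - q - 2). coeff (G M N \<xi> q) n * f (x + of_nat n * y))"
    using less by (intro sum.cong) (auto simp: coeff_G)
  then show ?thesis
    using sum_coeff_one_minus_X_power_mult[OF deg, of "q + 1" f x y]
    by (simp add: R beta atLeast0AtMost)
qed

lemma Delta_prod_Suc:
  "Delta_prod (Suc r) y q f = Delta_prod r y q (Delta (y (Suc r)) (q (Suc r)) f)"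
proof -
  \<comment> \<open>The new operator acts first, so it sits at the inner end of the fold, as its
    start value.\<close>
  have "foldr (\<circ>) Fs g = foldr (\<circ>) Fs id \<circ> g"
    for Fs and g :: "(complex \<Rightarrow> complex) \<Rightarrow> complex \<Rightarrow> complex"
    by (induction Fs) (auto simp: comp_assoc)
  from this[of _ "Delta _ _"] show ?thesis
    by (simp add: Delta_prod_def)
qed

text \<open>Each index tuple arises from exactly one choice of last entry \<open>a\<close> and one
  shorter tuple, by updating at \<open>Suc r\<close>.\<close>

lemma sum_PiE_Suc:
  "(\<Sum>n\<in>(\<Pi>\<^sub>E j\<in>{1..Suc r}. A j). h n) =
    (\<Sum>a\<in>A (Suc r). \<Sum>n\<in>(\<Pi>\<^sub>E j\<in>{1..r}. A j). h (n(Suc r := a)))"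
proof -
  have ins: "{1..Suc r} = insert (Suc r) {1..r}"
    by auto
  have "inj_on (\<lambda>(a, n). n(Suc r := a)) (A (Suc r) \<times> (\<Pi>\<^sub>E j\<in>{1..r}. A j))"
    by (rule inj_combinator) simp
  then show ?thesis
    unfolding ins PiE_insert_eq by (simp add: sum.reindex sum.cartesian_product case_prod_unfold)
qed

text \<open>The induction varies \<open>f\<close> and \<open>x\<close>, so that the hypothesis applies to
  \<open>Delta (y (Suc r)) (p (Suc r) + 1) f\<close> at shifted base points.\<close>

lemma sum_multi_shift_eq_sum_Delta_prod:
  assumes "M \<ge> 2" and "N \<ge> 1" and "\<not> rad M dvd rad N" and "primitive_root_of_unity M \<xi>"
  shows "(\<Sum>n\<in>(\<Pi>\<^sub>E j\<in>{1..r}. {0..M ^ (p j + 1) - 1}).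
            \<xi> ^ (\<Sum>j=1..r. base_shift M N (n j)) * f (x + (\<Sum>j=1..r. of_nat (n j) * y j)))
       = (-1) ^ (\<Sum>j=1..r. (p j + 1)) *
         (\<Sum>k\<in>(\<Pi>\<^sub>E j\<in>{1..r}. {0..M ^ (p j + 1) - p j - 2}).
            (\<Prod>j=1..r. beta M N \<xi> (p j) (k j)) *
            Delta_prod r y (\<lambda>j. p j + 1) f (x + (\<Sum>j=1..r. of_nat (k j) * y j)))"
proof (induction r arbitrary: f x)
  case 0
  then show ?case by (simp add: Delta_prod_def)
next
  case (Suc r)
  let ?P = "\<Pi>\<^sub>E j\<in>{1..r}. {0..M ^ (p j + 1) - 1}"
  let ?K = "\<Pi>\<^sub>E j\<in>{1..r}. {0..M ^ (p j + 1) - p j - 2}"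
  let ?q = "p (Suc r)" and ?z = "y (Suc r)"
  let ?g = "Delta ?z (?q + 1) f"
  let ?s = "\<lambda>n. \<Sum>j=1..r. of_nat (n j) * y j"
  let ?B = "\<lambda>n. \<xi> ^ (\<Sum>j=1..r. base_shift M N (n j))"
  let ?b = "\<lambda>k. \<Prod>j=1..r. beta M N \<xi> (p j) (k j)"
  \<comment> \<open>Setting coordinate \<open>Suc r\<close> does not affect sums over
    \<open>1..r\<close>. The result type is left general, since both the exponent in
    \<open>nat\<close> and the complex shift need this.\<close>
  have upd: "(\<Sum>j=1..r. w j ((n(Suc r := a)) j)) = (\<Sum>j=1..r. w j (n j))"
    for w :: "nat \<Rightarrow> nat \<Rightarrow> 'b::comm_monoid_add" and n a
    by (intro sum.cong) auto
  have updp: "(\<Prod>j=1..r. w j ((n(Suc r := a)) j)) = (\<Prod>j=1..r. w j (n j))"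
    for w :: "nat \<Rightarrow> nat \<Rightarrow> complex" and n a
    by (intro prod.cong) auto
  have "(\<Sum>n\<in>(\<Pi>\<^sub>E j\<in>{1..Suc r}. {0..M ^ (p j + 1) - 1}).
          \<xi> ^ (\<Sum>j=1..Suc r. base_shift M N (n j)) * f (x + (\<Sum>j=1..Suc r. of_nat (n j) * y j)))
      = (\<Sum>a=0..M ^ (?q + 1) - 1. \<Sum>n\<in>?P.
          ?B n * (\<xi> ^ base_shift M N a * f (x + ?s n + of_nat a * ?z)))"
    unfolding sum_PiE_Suc by (simp add: upd[of "\<lambda>_. base_shift M N"]
        upd[of "\<lambda>j m. of_nat m * y j"] power_add add.assoc mult.assoc del: fun_upd_apply)
      (simp add: mult.assoc)
  \<comment> \<open>The sum over \<open>a\<close> is the one-variable case with base point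
    \<open>x + ?s n\<close>.\<close>
  also have "\<dots> = (\<Sum>n\<in>?P. ?B n * ((-1) ^ (?q + 1) * (\<Sum>k=0..M ^ (?q + 1) - ?q - 2.
      beta M N \<xi> ?q k * ?g (x + ?s n + of_nat k * ?z))))"
    unfolding sum_shift_eq_sum_Delta[OF assms, symmetric]
    by (subst sum.swap) (simp only: sum_distrib_left)
  \<comment> \<open>With the sum over \<open>n\<close> moved inside, it is the left side of the
    induction hypothesis for \<open>?g\<close> at \<open>x + of_nat k * ?z\<close>.\<close>
  also have "\<dots> = (-1) ^ (?q + 1) * (\<Sum>k=0..M ^ (?q + 1) - ?q - 2. beta M N \<xi> ?q k *
      (\<Sum>n\<in>?P. ?B n * ?g (x + of_nat k * ?z + ?s n)))"
    unfolding sum_distrib_left by (subst sum.swap) (simp only: ac_simps)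
  also have "\<dots> = (-1) ^ (?q + 1) * (\<Sum>k=0..M ^ (?q + 1) - ?q - 2. beta M N \<xi> ?q k *
      ((-1) ^ (\<Sum>j=1..r. (p j + 1)) * (\<Sum>l\<in>?K. ?b l *
        Delta_prod r y (\<lambda>j. p j + 1) ?g (x + of_nat k * ?z + ?s l))))"
    unfolding Suc.IH ..
  also have "\<dots> = (-1) ^ (\<Sum>j=1..Suc r. (p j + 1)) * (\<Sum>k=0..M ^ (?q + 1) - ?q - 2. \<Sum>l\<in>?K.
      ?b l * beta M N \<xi> ?q k * Delta_prod (Suc r) y (\<lambda>j. p j + 1) f (x + (?s l + of_nat k * ?z)))"
    unfolding Delta_prod_Suc by (simp add: sum_distrib_left power_add ac_simps)
  also have "\<dots> = (-1) ^ (\<Sum>j=1..Suc r. (p j + 1)) *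
      (\<Sum>k\<in>(\<Pi>\<^sub>E j\<in>{1..Suc r}. {0..M ^ (p j + 1) - p j - 2}).
        (\<Prod>j=1..Suc r. beta M N \<xi> (p j) (k j)) *
        Delta_prod (Suc r) y (\<lambda>j. p j + 1) f (x + (\<Sum>j=1..Suc r. of_nat (k j) * y j)))"
    unfolding sum_PiE_Suc by (simp add: updp[of "\<lambda>j. beta M N \<xi> (p j)"]
        upd[of "\<lambda>j m. of_nat m * y j"] del: fun_upd_apply) simp
  finally show ?case .
qed

theorem theorem4p2:
  fixes M N r :: nat and \<xi> x :: complex and p :: "nat \<Rightarrow> nat" and y :: "nat \<Rightarrow> complex"
    and f :: "complex \<Rightarrow> complex"
  assumes "M \<ge> 2" and "N \<ge> 1" and "\<not> rad M dvd rad N"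
    and "primitive_root_of_unity M \<xi>"
    and "r \<ge> 1"
  shows "(\<Sum>n\<in>(\<Pi>\<^sub>E j\<in>{1..r}. {0..M ^ (p j + 1) - 1}).
            \<xi> ^ (\<Sum>j=1..r. base_shift M N (n j)) * f (x + (\<Sum>j=1..r. of_nat (n j) * y j)))
       = (-1) ^ (\<Sum>j=1..r. (p j + 1)) *
         (\<Sum>k\<in>(\<Pi>\<^sub>E j\<in>{1..r}. {0..M ^ (p j + 1) - p j - 2}).
            (\<Prod>j=1..r. beta M N \<xi> (p j) (k j)) *
            Delta_prod r y (\<lambda>j. p j + 1) f (x + (\<Sum>j=1..r. of_nat (k j) * y j)))"
  using assms(1-4) by (rule sum_multi_shift_eq_sum_Delta_prod)

end
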